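(* Let $W$ be a finite reflection group acting on $V=\mathbb{R}^n$ and let $B$ be a choice of fundamental chamber for $W$. Then the orbit realization space $\mathcal{R}_{\mathcal{O}}^W=\{\mathrm{conv}(W\cdot \mathbf{a}) : \mathbf{a}\in B\}$ is homeomorphic to $B$.
   Context: $W$ is a finite group generated by orthogonal reflections of Euclidean space $V=\mathbb{R}^n$, with root system $\Phi$. The $W$-braid arrangement is the union of the hyperplanes $H_\alpha=\alpha^\perp$, $\alpha\in\Phi$. A chamber is a connected component of its complement; equivalently a set $\{c\in V : \langle c,\alpha\rangle>0 \text{ for all } \alpha\in\Phi_+\}$ for a positive system $\Phi_+\subset \Phi$. $B$ is one fixed (open) chamber, called the fundamental chamber, with its Euclidean topology. Topology on $\mathcal{R}_{\mathcal{O}}^W$: fix an ordering of $W$ with the identity first. The polytope $\mathrm{conv}(W\cdot\mathbf{a})$ ($\mathbf{a}\in B$) has vertices $w\cdot\mathbf{a}$ labeled bijectively by $w\in W$, and is identified with the $|W|\times n$ matrix whose $w$-th row is $w\cdot\mathbf{a}$. In this way $\mathcal{R}_{\mathcal{O}}^W\subseteq\mathbb{R}^{n\cdot|W|}$, and it carries the subspace topology. *)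

theory Defs
  imports "HOL-Analysis.Analysis" "HOL-Algebra.Generated_Groups"
begin

definition reflection :: "real^'n \<Rightarrow> real^'n \<Rightarrow> real^'n" where
  "reflection \<alpha> x = x - (2 * (x \<bullet> \<alpha>) / (\<alpha> \<bullet> \<alpha>)) *\<^sub>R \<alpha>"

definition orthogonal_group :: "(real^'n \<Rightarrow> real^'n) monoid" where
  "orthogonal_group =
     \<lparr>carrier = {f. orthogonal_transformation f}, monoid.mult = (\<lambda>f g. f \<circ> g), one = id\<rparr>"

definition finite_reflection_group :: "(real^'n \<Rightarrow> real^'n) set \<Rightarrow> bool" where
  "finite_reflection_group W \<longleftrightarrow>
     finite W \<and> (\<exists>S. 0 \<notin> S \<and> W = generate orthogonal_group (reflection ` S))"

text \<open>Root systems in the sense of reflection groups: reduced, but neither crystallographic nor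
  spanning.\<close>

definition root_system :: "(real^'n) set \<Rightarrow> bool" where
  "root_system \<Phi> \<longleftrightarrow>
     finite \<Phi> \<and> 0 \<notin> \<Phi> \<and>
     (\<forall>\<alpha>\<in>\<Phi>. \<Phi> \<inter> span {\<alpha>} = {\<alpha>, - \<alpha>}) \<and>
     (\<forall>\<alpha>\<in>\<Phi>. reflection \<alpha> ` \<Phi> = \<Phi>)"

definition root_system_of :: "(real^'n \<Rightarrow> real^'n) set \<Rightarrow> (real^'n) set \<Rightarrow> bool" where
  "root_system_of W \<Phi> \<longleftrightarrow>
     root_system \<Phi> \<and> W = generate orthogonal_group (reflection ` \<Phi>)"

definition root_hyperplane :: "real^'n \<Rightarrow> (real^'n) set" where
  "root_hyperplane \<alpha> = {x. \<alpha> \<bullet> x = 0}"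

definition chambers :: "(real^'n) set \<Rightarrow> (real^'n) set set" where
  "chambers \<Phi> = components (- (\<Union>\<alpha>\<in>\<Phi>. root_hyperplane \<alpha>))"

definition orbit_polytope :: "(real^'n \<Rightarrow> real^'n) set \<Rightarrow> real^'n \<Rightarrow> (real^'n) set" where
  "orbit_polytope W a = convex hull ((\<lambda>w. w a) ` W)"

definition orbit_realizations ::
    "(real^'n \<Rightarrow> real^'n) set \<Rightarrow> (real^'n) set \<Rightarrow> (real^'n) set set" where
  "orbit_realizations W B = orbit_polytope W ` B"

definition group_ordering ::
    "(real^'n \<Rightarrow> real^'n) set \<Rightarrow> (real^'n \<Rightarrow> real^'n) list \<Rightarrow> bool" where
  "group_ordering W ws \<longleftrightarrow> distinct ws \<and> set ws = W \<and> hd ws = id"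

definition orbit_matrix ::
    "(real^'n \<Rightarrow> real^'n) list \<Rightarrow> real^'n \<Rightarrow> nat \<times> 'n \<Rightarrow> real" where
  "orbit_matrix ws a = (\<lambda>(i, j)\<in>{..<length ws} \<times> UNIV. (ws ! i) a $ j)"

text \<open>The vertex matrix of a polytope in the orbit realization space.  Its \<open>i\<close>-th row is the vertex
  labeled by \<open>ws ! i\<close>; the labeling is determined by the polytope because the generating point
  in the chamber \<open>B\<close> is unique (it is the only vertex lying in \<open>B\<close>).\<close>

definition realization_matrix ::
    "(real^'n \<Rightarrow> real^'n) set \<Rightarrow> (real^'n) set \<Rightarrow> (real^'n \<Rightarrow> real^'n) list \<Rightarrow>
     (real^'n) set \<Rightarrow> nat \<times> 'n \<Rightarrow> real" where
  "realization_matrix W B ws P =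
     orbit_matrix ws (THE a. a \<in> B \<and> P = orbit_polytope W a)"

text \<open>The polytopes carry the subspace topology under their identification with points of the
  space of \<open>|W|\<close> by \<open>n\<close> real matrices.\<close>

definition orbit_realization_space ::
    "(real^'n \<Rightarrow> real^'n) set \<Rightarrow> (real^'n) set \<Rightarrow> (real^'n \<Rightarrow> real^'n) list \<Rightarrow>
     (real^'n) set topology" where
  "orbit_realization_space W B ws =
     pullback_topology (orbit_realizations W B) (realization_matrix W B ws)
       (powertop_real ({..<length ws} \<times> UNIV))"

end

theory Submission
  imports Defs
begin

text \<open>The candidate homeomorphism from \<open>B\<close> sends \<open>a\<close> to the polytope \<open>conv (W a)\<close>.  Seen in the
  space of matrices, it maps \<open>a\<close> to the matrix with rows \<open>w a\<close>, which is linear in \<open>a\<close>; the row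
  labeled by the identity gives \<open>a\<close> back, so the inverse is a coordinate projection.  All the
  content therefore lies in the fact that the polytope determines \<open>a\<close>
  (\<open>orbit_polytope_inj_on_chamber\<close>), which is also what makes the vertex labeling well defined.

  The vertices of the polytope are exactly the orbit points, because these all have the same norm.
  So two points of \<open>B\<close> with the same polytope are \<open>W\<close>-conjugate, and it remains to see that an
  orbit meets \<open>B\<close> at most once (\<open>reflection_group_orbit_chamber_unique\<close>).  If \<open>a\<close> and \<open>w a\<close> both lie
  in \<open>B\<close>, then \<open>w\<close> preserves the set of roots that are positive on \<open>B\<close>, and such a \<open>w\<close> is the
  identity: \<open>W\<close> is generated by the reflections in the walls of \<open>B\<close>
  (\<open>reflection_word_simple_word\<close>), and a nonempty word in these that preserves positivity can be
  shortened by the exchange argument (\<open>positivity_preserving_word_id\<close>).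

  The walls are found by following a generic segment out of the chamber
  (\<open>simple_root_separates\<close>).  Positivity of roots is measured by the inner product with one point
  \<open>b\<close> of the chamber; by connectedness all its points give the same signs.\<close>

section \<open>Reflections and words of reflections\<close>

lemma orthogonal_transformation_reflection: "orthogonal_transformation (reflection \<alpha>)"
proof (cases "\<alpha> = 0")
  case True
  then show ?thesis
    by (simp add: reflection_def[abs_def] orthogonal_transformation_def)
next
  case False
  have "linear (reflection \<alpha>)"
    by (rule linearI)
      (simp_all add: reflection_def inner_add_left scaleR_add_left add_divide_distrib
        distrib_left scaleR_diff_right)
  moreover have "reflection \<alpha> v \<bullet> reflection \<alpha> w = v \<bullet> w" for v w
    using False
    by (simp add: reflection_def inner_diff_left inner_diff_right inner_commute field_simps)
  ultimately show ?thesis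
    by (simp add: orthogonal_transformation_def)
qed

lemmas reflection_linear = orthogonal_transformation_linear[OF orthogonal_transformation_reflection]

lemma reflection_self [simp]: "reflection \<alpha> \<alpha> = - \<alpha>"
  by (cases "\<alpha> = 0") (simp_all add: reflection_def scaleR_2)

lemma reflection_minus [simp]: "reflection \<alpha> (- x) = - reflection \<alpha> x"
  by (rule linear_neg[OF reflection_linear])

lemma reflection_root_minus [simp]: "reflection (- \<alpha>) = reflection \<alpha>"
  by (rule ext) (simp add: reflection_def)

lemma reflection_involution [simp]: "reflection \<alpha> (reflection \<alpha> x) = x"
proof -
  have "reflection \<alpha> x \<bullet> \<alpha> = - (x \<bullet> \<alpha>)"
    by (cases "\<alpha> = 0") (simp_all add: reflection_def inner_diff_left)
  then show ?thesis
    by (simp add: reflection_def[of \<alpha> "reflection \<alpha> x"]) (simp add: reflection_def)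
qed

lemma reflection_orthogonal_image:
  assumes "orthogonal_transformation f"
  shows "reflection (f \<alpha>) (f x) = f (reflection \<alpha> x)"
proof -
  have l: "linear f" and i: "f v \<bullet> f w = v \<bullet> w" for v w
    using assms by (auto simp: orthogonal_transformation_def)
  show ?thesis
    by (simp add: reflection_def i linear_diff[OF l] linear_cmul[OF l])
qed

lemma reflection_comp_self [simp]: "reflection \<alpha> \<circ> reflection \<alpha> = id"
  by (rule ext) simp

definition reflection_word :: "(real^'n) list \<Rightarrow> real^'n \<Rightarrow> real^'n" where
  "reflection_word \<alpha>s = foldr (\<lambda>\<alpha> f. reflection \<alpha> \<circ> f) \<alpha>s id"

lemma reflection_word_Nil [simp]: "reflection_word [] = id"
  and reflection_word_Cons [simp]:
    "reflection_word (\<alpha> # \<alpha>s) = reflection \<alpha> \<circ> reflection_word \<alpha>s"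
  by (simp_all add: reflection_word_def)

lemma reflection_word_append [simp]:
  "reflection_word (\<alpha>s @ \<beta>s) = reflection_word \<alpha>s \<circ> reflection_word \<beta>s"
  by (induction \<alpha>s) (simp_all add: comp_assoc)

lemma orthogonal_transformation_reflection_word:
  "orthogonal_transformation (reflection_word \<alpha>s)"
proof (induction \<alpha>s)
  case Nil
  show ?case by (simp add: orthogonal_transformation_def)
next
  case (Cons \<alpha> \<alpha>s)
  then show ?case
    unfolding reflection_word_Cons
    by (rule orthogonal_transformation_compose[OF orthogonal_transformation_reflection])
qed

lemma reflection_word_minus [simp]: "reflection_word \<alpha>s (- x) = - reflection_word \<alpha>s x"
  by (rule linear_neg[OF orthogonal_transformation_linear])
    (rule orthogonal_transformation_reflection_word)

lemma inv_orthogonal_group_reflection: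
  "inv\<^bsub>orthogonal_group\<^esub> (reflection \<alpha>) = reflection \<alpha>"
  unfolding m_inv_def
proof (rule the_equality)
  fix y
  assume "y \<in> carrier orthogonal_group \<and> reflection \<alpha> \<otimes>\<^bsub>orthogonal_group\<^esub> y = \<one>\<^bsub>orthogonal_group\<^esub>
    \<and> y \<otimes>\<^bsub>orthogonal_group\<^esub> reflection \<alpha> = \<one>\<^bsub>orthogonal_group\<^esub>"
  then have *: "reflection \<alpha> \<circ> y = id"
    by (simp add: orthogonal_group_def)
  show "y = reflection \<alpha>"
  proof
    fix x
    have "reflection \<alpha> (y x) = x"
      using fun_cong[OF *, of x] by simp
    then show "y x = reflection \<alpha> x"
      by (metis reflection_involution)
  qed
qed (simp add: orthogonal_group_def orthogonal_transformation_reflection)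

text \<open>Reflections are involutions, so the group inverses in the generation process add nothing:
  every element is a product of generators.\<close>

lemma generate_reflections_word:
  assumes "w \<in> generate orthogonal_group (reflection ` S)"
  obtains \<alpha>s where "set \<alpha>s \<subseteq> S" "w = reflection_word \<alpha>s"
proof -
  from assms have "\<exists>\<alpha>s. set \<alpha>s \<subseteq> S \<and> w = reflection_word \<alpha>s"
  proof induction
    case one
    show ?case
      by (rule exI[of _ "[]"]) (simp add: orthogonal_group_def)
  next
    case (incl h)
    then obtain \<alpha> where "\<alpha> \<in> S" "h = reflection \<alpha>" by auto
    then show ?case
      by (intro exI[of _ "[\<alpha>]"]) simp
  next
    case (inv h)
    then obtain \<alpha> where "\<alpha> \<in> S" "h = reflection \<alpha>" by auto
    then show ?case
      by (intro exI[of _ "[\<alpha>]"]) (simp add: inv_orthogonal_group_reflection)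
  next
    case (eng h1 h2)
    then obtain \<alpha>s \<beta>s where "set \<alpha>s \<subseteq> S" "h1 = reflection_word \<alpha>s"
      "set \<beta>s \<subseteq> S" "h2 = reflection_word \<beta>s" by auto
    then show ?case
      by (intro exI[of _ "\<alpha>s @ \<beta>s"]) (simp add: orthogonal_group_def)
  qed
  then show thesis using that by blast
qed

section \<open>Positive and simple roots\<close>

definition regular_point :: "(real^'n) set \<Rightarrow> real^'n \<Rightarrow> bool" where
  "regular_point \<Phi> b \<longleftrightarrow> (\<forall>\<beta>\<in>\<Phi>. b \<bullet> \<beta> \<noteq> 0)"

definition positive_roots :: "(real^'n) set \<Rightarrow> real^'n \<Rightarrow> (real^'n) set" where
  "positive_roots \<Phi> b = {\<beta> \<in> \<Phi>. b \<bullet> \<beta> > 0}"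

text \<open>Instead of being indecomposable, simple roots are characterised here by the property that
  the exchange argument uses: the reflection makes no other positive root negative.\<close>

definition simple_roots :: "(real^'n) set \<Rightarrow> real^'n \<Rightarrow> (real^'n) set" where
  "simple_roots \<Phi> b =
     {\<alpha> \<in> positive_roots \<Phi> b.
        \<forall>\<beta> \<in> positive_roots \<Phi> b - {\<alpha>}. reflection \<alpha> \<beta> \<in> positive_roots \<Phi> b}"

lemma root_reflection: "root_system \<Phi> \<Longrightarrow> \<alpha> \<in> \<Phi> \<Longrightarrow> \<beta> \<in> \<Phi> \<Longrightarrow> reflection \<alpha> \<beta> \<in> \<Phi>"
  unfolding root_system_def by blast

lemma root_minus: "root_system \<Phi> \<Longrightarrow> \<alpha> \<in> \<Phi> \<Longrightarrow> - \<alpha> \<in> \<Phi>"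
  by (metis reflection_self root_reflection)

lemma positive_or_negative_root:
  assumes "root_system \<Phi>" "regular_point \<Phi> b" "\<beta> \<in> \<Phi>"
  shows "\<beta> \<in> positive_roots \<Phi> b \<or> - \<beta> \<in> positive_roots \<Phi> b"
  using assms root_minus[OF assms(1,3)] by (force simp: positive_roots_def regular_point_def)

lemma positive_roots_proportional:
  assumes "root_system \<Phi>" "\<alpha> \<in> positive_roots \<Phi> b" "\<beta> \<in> positive_roots \<Phi> b" "\<beta> = c *\<^sub>R \<alpha>"
  shows "\<beta> = \<alpha>"
proof -
  have "\<beta> \<in> \<Phi> \<inter> span {\<alpha>}"
    using assms by (auto simp: positive_roots_def span_singleton)
  moreover have "\<Phi> \<inter> span {\<alpha>} = {\<alpha>, - \<alpha>}"
    using assms(1,2) by (auto simp: root_system_def positive_roots_def)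
  ultimately have "\<beta> = \<alpha> \<or> \<beta> = - \<alpha>" by blast
  with assms(2,3) show ?thesis
    by (auto simp: positive_roots_def)
qed

text \<open>A point lying on the hyperplane of \<open>\<alpha>\<close> and strictly on the positive side of all the other
  hyperplanes exhibits \<open>\<alpha>\<close> as a wall.  It is fixed by the reflection in \<open>\<alpha>\<close>, so that reflection
  preserves the sign of every other root at this point.\<close>

lemma simple_rootI:
  assumes rs: "root_system \<Phi>" and reg: "regular_point \<Phi> b"
    and \<alpha>: "\<alpha> \<in> positive_roots \<Phi> b" and z0: "z \<bullet> \<alpha> = 0"
    and zpos: "\<And>\<beta>. \<beta> \<in> positive_roots \<Phi> b \<Longrightarrow> \<beta> \<noteq> \<alpha> \<Longrightarrow> z \<bullet> \<beta> > 0"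
  shows "\<alpha> \<in> simple_roots \<Phi> b"
proof -
  have "reflection \<alpha> \<beta> \<in> positive_roots \<Phi> b"
    if \<beta>: "\<beta> \<in> positive_roots \<Phi> b" "\<beta> \<noteq> \<alpha>" for \<beta>
  proof (rule ccontr)
    assume "reflection \<alpha> \<beta> \<notin> positive_roots \<Phi> b"
    moreover have "reflection \<alpha> \<beta> \<in> \<Phi>"
      using root_reflection[OF rs] \<alpha> \<beta> by (auto simp: positive_roots_def)
    ultimately have neg: "- reflection \<alpha> \<beta> \<in> positive_roots \<Phi> b"
      using positive_or_negative_root[OF rs reg] by blast
    have "z \<bullet> reflection \<alpha> \<beta> = z \<bullet> \<beta>"
      using z0 by (simp add: reflection_def inner_diff_right)
    with zpos[OF \<beta>] zpos[OF neg] have "- reflection \<alpha> \<beta> = \<alpha>"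
      by force
    then have "reflection \<alpha> (- reflection \<alpha> \<beta>) = - \<alpha>"
      by simp
    with \<beta>(2) show False by simp
  qed
  with \<alpha> show ?thesis by (auto simp: simple_roots_def)
qed

text \<open>Any finite family of hyperplanes has measure zero, so a point can be moved off them while
  finitely many strict linear inequalities persist.\<close>

lemma generic_point:
  assumes "finite P" "finite N" "\<And>\<beta>. \<beta> \<in> P \<Longrightarrow> b \<bullet> \<beta> > 0" "0 \<notin> N"
  obtains c :: "real^'n" where "\<And>\<beta>. \<beta> \<in> P \<Longrightarrow> c \<bullet> \<beta> > 0" "\<And>\<nu>. \<nu> \<in> N \<Longrightarrow> c \<bullet> \<nu> \<noteq> 0"
proof -
  define U where "U = (\<Inter>\<beta>\<in>P. {y. y \<bullet> \<beta> > 0})"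
  have "open U"
    unfolding U_def using assms(1)
    by (subst inner_commute) (intro open_INT ballI open_halfspace_gt)
  moreover have "b \<in> U"
    using assms(3) by (auto simp: U_def)
  ultimately have "\<not> negligible U"
    using open_not_negligible by blast
  moreover have "negligible (\<Union>\<nu>\<in>N. {y. \<nu> \<bullet> y = 0})"
    using assms(2,4) by (intro negligible_Union) (auto intro!: negligible_hyperplane)
  ultimately have "\<not> U \<subseteq> (\<Union>\<nu>\<in>N. {y. \<nu> \<bullet> y = 0})"
    using negligible_subset by blast
  then obtain c where "c \<in> U" "\<And>\<nu>. \<nu> \<in> N \<Longrightarrow> \<nu> \<bullet> c \<noteq> 0" by blast
  then show thesis
    by (intro that[of c]) (auto simp: U_def inner_commute)
qed

text \<open>Simple roots suffice to detect that a point is outside the closed chamber.  Walk along the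
  segment from a generic point \<open>c\<close> of the chamber to \<open>x\<close>: genericity makes the first hyperplane
  met the only one met at that moment, and it is therefore a wall.\<close>

lemma simple_root_separates:
  assumes rs: "root_system \<Phi>" and reg: "regular_point \<Phi> b"
    and \<gamma>: "\<gamma> \<in> positive_roots \<Phi> b" and x\<gamma>: "x \<bullet> \<gamma> < 0"
  obtains \<alpha> where "\<alpha> \<in> simple_roots \<Phi> b" "x \<bullet> \<alpha> < 0"
proof -
  define P where "P = positive_roots \<Phi> b"
  define D where "D = {\<beta> \<in> P. x \<bullet> \<beta> < 0}"
  \<comment> \<open>\<open>d (\<alpha>, \<beta>)\<close> is orthogonal to a chamber point \<open>c\<close> exactly when the segment from \<open>c\<close> to
    \<open>x\<close> meets the hyperplanes of \<open>\<alpha>\<close> and \<open>\<beta>\<close> simultaneously.\<close>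
  define d where "d = (\<lambda>(\<alpha>, \<beta>). (x \<bullet> \<beta>) *\<^sub>R \<alpha> - (x \<bullet> \<alpha>) *\<^sub>R \<beta>)"
  define N where "N = d ` {(\<alpha>, \<beta>) \<in> D \<times> D. \<alpha> \<noteq> \<beta>}"
  have finP: "finite P"
    using rs by (auto simp: P_def positive_roots_def root_system_def)
  then have finD: "finite D" by (simp add: D_def)
  have finN: "finite N"
    unfolding N_def by (rule finite_imageI, rule finite_subset[of _ "D \<times> D"]) (use finD in auto)
  have "0 \<notin> N"
  proof
    assume "0 \<in> N"
    then obtain \<alpha> \<beta> where ab: "\<alpha> \<in> D" "\<beta> \<in> D" "\<alpha> \<noteq> \<beta>"
      and "(x \<bullet> \<beta>) *\<^sub>R \<alpha> = (x \<bullet> \<alpha>) *\<^sub>R \<beta>"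
      by (auto simp: N_def d_def)
    then have "inverse (x \<bullet> \<alpha>) *\<^sub>R (x \<bullet> \<beta>) *\<^sub>R \<alpha> = inverse (x \<bullet> \<alpha>) *\<^sub>R (x \<bullet> \<alpha>) *\<^sub>R \<beta>"
      by simp
    then have "\<beta> = (inverse (x \<bullet> \<alpha>) * (x \<bullet> \<beta>)) *\<^sub>R \<alpha>"
      using ab by (simp add: D_def)
    then have "\<beta> = \<alpha>"
      using positive_roots_proportional[OF rs] ab unfolding D_def P_def by blast
    with ab show False by simp
  qed
  then obtain c where cP: "\<And>\<beta>. \<beta> \<in> P \<Longrightarrow> c \<bullet> \<beta> > 0" and cN: "\<And>\<nu>. \<nu> \<in> N \<Longrightarrow> c \<bullet> \<nu> \<noteq> 0"
    using generic_point[OF finP finN, of b] by (auto simp: P_def positive_roots_def)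
  \<comment> \<open>Up to positive factors, which leave all signs alone, the points of the segment are those of
    the ray \<open>c + t *\<^sub>R x\<close>.  It meets the hyperplane of \<open>\<beta>\<close> at time \<open>t = cross \<beta>\<close>, and \<open>c\<close> was
    chosen off \<open>N\<close> so that no two of these times agree.\<close>
  define cross where "cross = (\<lambda>\<beta>. (c \<bullet> \<beta>) / - (x \<bullet> \<beta>))"
  have "D \<noteq> {}"
    using \<gamma> x\<gamma> by (auto simp: D_def P_def)
  then obtain \<alpha> where \<alpha>: "\<alpha> \<in> D" and min: "\<And>\<beta>. \<beta> \<in> D \<Longrightarrow> cross \<alpha> \<le> cross \<beta>"
    using finD arg_min_if_finite(1) arg_min_least by metis
  define z where "z = c + cross \<alpha> *\<^sub>R x"
  have z\<alpha>: "z \<bullet> \<alpha> = 0"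
    using \<alpha> by (auto simp: z_def cross_def D_def inner_add_left inner_diff_left)
  have pos: "cross \<alpha> > 0"
    using \<alpha> cP unfolding cross_def D_def by (intro divide_pos_pos) auto
  have "z \<bullet> \<beta> > 0" if \<beta>: "\<beta> \<in> P" "\<beta> \<noteq> \<alpha>" for \<beta>
  proof (cases "x \<bullet> \<beta> < 0")
    case False
    then have "z \<bullet> \<beta> \<ge> c \<bullet> \<beta>"
      using pos by (simp add: z_def inner_add_left)
    then show ?thesis using cP[OF \<beta>(1)] by simp
  next
    case True
    then have \<beta>D: "\<beta> \<in> D" using \<beta> by (simp add: D_def)
    then have "c \<bullet> d (\<alpha>, \<beta>) \<noteq> 0"
      using \<alpha> \<beta> by (intro cN) (auto simp: N_def)
    then have "cross \<alpha> \<noteq> cross \<beta>"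
      using True \<alpha> by (auto simp: d_def cross_def D_def inner_diff_right field_simps)
    then have "cross \<alpha> < cross \<beta>"
      using min[OF \<beta>D] by simp
    then show ?thesis
      using True by (simp add: z_def cross_def inner_add_left inner_diff_left field_simps)
  qed
  then have "\<alpha> \<in> simple_roots \<Phi> b"
    using simple_rootI[OF rs reg _ z\<alpha>] \<alpha> by (auto simp: D_def P_def)
  with \<alpha> show thesis
    by (intro that[of \<alpha>]) (auto simp: D_def)
qed

section \<open>Words in the simple reflections\<close>

text \<open>Descent on the height \<open>b \<bullet> \<beta>\<close>.  A positive root \<open>\<beta>\<close> has positive inner product with some
  simple root, because \<open>- \<beta>\<close> is separated from the chamber by \<open>\<beta>\<close> itself; reflecting in that
  simple root lowers the height and conjugates the reflection.\<close>

lemma reflection_simple_word: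
  assumes rs: "root_system \<Phi>" and reg: "regular_point \<Phi> b" and "\<beta> \<in> positive_roots \<Phi> b"
  shows "\<exists>\<alpha>s. set \<alpha>s \<subseteq> simple_roots \<Phi> b \<and> reflection \<beta> = reflection_word \<alpha>s"
  using assms(3)
proof (induction "card {\<delta> \<in> positive_roots \<Phi> b. b \<bullet> \<delta> < b \<bullet> \<beta>}" arbitrary: \<beta>
    rule: less_induct)
  case less
  have finP: "finite (positive_roots \<Phi> b)"
    using rs by (auto simp: positive_roots_def root_system_def)
  have "- \<beta> \<bullet> \<beta> < 0"
    using less.prems by (auto simp: positive_roots_def)
  then obtain \<alpha> where \<alpha>: "\<alpha> \<in> simple_roots \<Phi> b" and \<beta>\<alpha>: "\<beta> \<bullet> \<alpha> > 0"
    using simple_root_separates[OF rs reg less.prems, of "- \<beta>"] by auto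
  show ?case
  proof (cases "\<beta> = \<alpha>")
    case True
    then show ?thesis
      using \<alpha> by (intro exI[of _ "[\<alpha>]"]) simp
  next
    case False
    define \<gamma> where "\<gamma> = reflection \<alpha> \<beta>"
    have \<gamma>: "\<gamma> \<in> positive_roots \<Phi> b"
      using \<alpha> less.prems False by (auto simp: \<gamma>_def simple_roots_def)
    have "b \<bullet> \<alpha> > 0" "\<alpha> \<bullet> \<alpha> > 0"
      using \<alpha> by (auto simp: simple_roots_def positive_roots_def)
    then have lower: "b \<bullet> \<gamma> < b \<bullet> \<beta>"
      using \<beta>\<alpha> by (simp add: \<gamma>_def reflection_def inner_diff_right)
    have "card {\<delta> \<in> positive_roots \<Phi> b. b \<bullet> \<delta> < b \<bullet> \<gamma>}
        < card {\<delta> \<in> positive_roots \<Phi> b. b \<bullet> \<delta> < b \<bullet> \<beta>}"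
      using finP \<gamma> lower by (intro psubset_card_mono) auto
    from less.hyps[OF this \<gamma>] obtain \<alpha>s
      where \<alpha>s: "set \<alpha>s \<subseteq> simple_roots \<Phi> b" "reflection \<gamma> = reflection_word \<alpha>s"
      by blast
    have "reflection \<beta> = reflection \<alpha> \<circ> (reflection \<gamma> \<circ> reflection \<alpha>)"
    proof
      fix x
      have "reflection \<gamma> (reflection \<alpha> x) = reflection \<alpha> (reflection \<beta> x)"
        unfolding \<gamma>_def
        by (rule reflection_orthogonal_image[OF orthogonal_transformation_reflection])
      then show "reflection \<beta> x = (reflection \<alpha> \<circ> (reflection \<gamma> \<circ> reflection \<alpha>)) x"
        by simp
    qed
    then show ?thesis
      using \<alpha> \<alpha>s by (intro exI[of _ "\<alpha> # \<alpha>s @ [\<alpha>]"]) simp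
  qed
qed

lemma reflection_word_simple_word:
  assumes rs: "root_system \<Phi>" and reg: "regular_point \<Phi> b" and "set \<beta>s \<subseteq> \<Phi>"
  shows "\<exists>\<alpha>s. set \<alpha>s \<subseteq> simple_roots \<Phi> b \<and> reflection_word \<beta>s = reflection_word \<alpha>s"
  using assms(3)
proof (induction \<beta>s)
  case Nil
  show ?case by (intro exI[of _ "[]"]) simp
next
  case (Cons \<beta> \<beta>s)
  then obtain \<alpha>s where \<alpha>s: "set \<alpha>s \<subseteq> simple_roots \<Phi> b" "reflection_word \<beta>s = reflection_word \<alpha>s"
    by auto
  have "\<beta> \<in> positive_roots \<Phi> b \<or> - \<beta> \<in> positive_roots \<Phi> b"
    using Cons.prems by (intro positive_or_negative_root[OF rs reg]) simp
  then obtain \<delta>s where "set \<delta>s \<subseteq> simple_roots \<Phi> b" "reflection \<beta> = reflection_word \<delta>s"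
    using reflection_simple_word[OF rs reg] by (metis reflection_root_minus)
  with \<alpha>s show ?case
    by (intro exI[of _ "\<delta>s @ \<alpha>s"]) simp
qed

lemma reflection_word_root:
  assumes "root_system \<Phi>" "set \<alpha>s \<subseteq> \<Phi>" "\<beta> \<in> \<Phi>"
  shows "reflection_word \<alpha>s \<beta> \<in> \<Phi>"
  using assms by (induction \<alpha>s) (auto intro: root_reflection)

text \<open>When a word of simple reflections turns a negative root positive, the sign changes at some
  letter, and a simple reflection changes the sign of its own root only.\<close>

lemma sign_change_in_simple_word:
  assumes rs: "root_system \<Phi>" and reg: "regular_point \<Phi> b"
    and "set \<alpha>s \<subseteq> simple_roots \<Phi> b" and \<gamma>: "\<gamma> \<in> \<Phi>" "b \<bullet> \<gamma> < 0"
    and "b \<bullet> reflection_word \<alpha>s \<gamma> > 0"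
  shows "\<exists>xs \<delta> ys. \<alpha>s = xs @ \<delta> # ys \<and> reflection_word ys \<gamma> = - \<delta>"
  using assms(3,6)
proof (induction \<alpha>s)
  case Nil
  with \<gamma> show ?case by simp
next
  case (Cons \<delta> ys)
  define \<eta> where "\<eta> = reflection_word ys \<gamma>"
  have "set ys \<subseteq> \<Phi>"
    using Cons.prems by (auto simp: simple_roots_def positive_roots_def)
  then have \<eta>: "\<eta> \<in> \<Phi>"
    unfolding \<eta>_def by (intro reflection_word_root[OF rs _ \<gamma>(1)])
  show ?case
  proof (cases "b \<bullet> \<eta> > 0")
    case True
    then obtain xs \<epsilon> zs where "ys = xs @ \<epsilon> # zs" "reflection_word zs \<gamma> = - \<epsilon>"
      using Cons by (auto simp: \<eta>_def)
    then show ?thesis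
      by (intro exI[of _ "\<delta> # xs"] exI[of _ \<epsilon>] exI[of _ zs]) simp
  next
    case False
    then have neg: "- \<eta> \<in> positive_roots \<Phi> b"
      using positive_or_negative_root[OF rs reg \<eta>] by (auto simp: positive_roots_def)
    have "- \<eta> = \<delta>"
    proof (rule ccontr)
      assume "- \<eta> \<noteq> \<delta>"
      then have "reflection \<delta> (- \<eta>) \<in> positive_roots \<Phi> b"
        using neg Cons.prems(1) unfolding simple_roots_def list.set by blast
      then show False
        using Cons.prems(2) by (simp add: positive_roots_def \<eta>_def)
    qed
    then show ?thesis
      by (intro exI[of _ "[]"] exI[of _ \<delta>] exI[of _ ys]) (auto simp: \<eta>_def)
  qed
qed

text \<open>The exchange argument.  In a shortest simple word, the last letter \<open>\<alpha>\<close> makes the root \<open>\<alpha>\<close>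
  negative, so an earlier letter \<open>\<delta>\<close> must make it positive again; then the two letters are
  conjugate by the subword between them, and both can be deleted.\<close>

lemma positivity_preserving_word_id:
  assumes rs: "root_system \<Phi>" and reg: "regular_point \<Phi> b" and \<beta>s: "set \<beta>s \<subseteq> \<Phi>"
    and pos: "\<And>\<beta>. \<beta> \<in> positive_roots \<Phi> b \<Longrightarrow> b \<bullet> reflection_word \<beta>s \<beta> > 0"
  shows "reflection_word \<beta>s = id"
proof -
  define Q where
    "Q = (\<lambda>\<alpha>s. set \<alpha>s \<subseteq> simple_roots \<Phi> b \<and> reflection_word \<beta>s = reflection_word \<alpha>s)"
  have "\<exists>\<alpha>s. Q \<alpha>s"
    unfolding Q_def by (rule reflection_word_simple_word[OF rs reg \<beta>s])
  then obtain \<alpha>s where Q: "Q \<alpha>s" and min: "\<And>\<delta>s. Q \<delta>s \<Longrightarrow> length \<alpha>s \<le> length \<delta>s"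
    using ex_has_least_nat[of Q _ length] by blast
  show ?thesis
  proof (cases \<alpha>s rule: rev_cases)
    case Nil
    with Q show ?thesis by (simp add: Q_def)
  next
    case (snoc us \<alpha>)
    have us: "set us \<subseteq> simple_roots \<Phi> b" and \<alpha>: "\<alpha> \<in> simple_roots \<Phi> b"
      and word: "reflection_word \<beta>s = reflection_word us \<circ> reflection \<alpha>"
      using Q snoc by (auto simp: Q_def)
    have \<alpha>': "\<alpha> \<in> positive_roots \<Phi> b"
      using \<alpha> by (simp add: simple_roots_def)
    then have "- \<alpha> \<in> \<Phi>" "b \<bullet> - \<alpha> < 0"
      using root_minus[OF rs] by (auto simp: positive_roots_def)
    moreover have "b \<bullet> reflection_word us (- \<alpha>) > 0"
      using pos[OF \<alpha>'] by (simp add: word)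
    ultimately obtain xs \<delta> ys where us_eq: "us = xs @ \<delta> # ys" and "reflection_word ys (- \<alpha>) = - \<delta>"
      using sign_change_in_simple_word[OF rs reg us] by blast
    then have \<delta>: "\<delta> = reflection_word ys \<alpha>" by simp
    have "reflection \<delta> (reflection_word ys (reflection \<alpha> x)) = reflection_word ys x" for x
      unfolding \<delta>
      by (simp add: reflection_orthogonal_image[OF orthogonal_transformation_reflection_word])
    then have "reflection_word \<beta>s = reflection_word (xs @ ys)"
      by (auto simp: word us_eq)
    then have "Q (xs @ ys)"
      using us by (simp add: Q_def us_eq)
    from min[OF this] show ?thesis
      by (simp add: snoc us_eq)
  qed
qed

section \<open>Orbits meet a chamber at most once\<close>

lemma chamber_root_sign:
  assumes "B \<in> chambers \<Phi>" "\<alpha> \<in> \<Phi>" "a \<in> B" "b \<in> B" "a \<bullet> \<alpha> > 0"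
  shows "b \<bullet> \<alpha> > 0"
proof (rule ccontr)
  assume "\<not> b \<bullet> \<alpha> > 0"
  moreover have "connected B"
    using assms(1) by (auto simp: chambers_def in_components_connected)
  ultimately obtain z where "z \<in> B" "\<alpha> \<bullet> z = 0"
    using connected_ivt_hyperplane[of B b a \<alpha> 0] assms by (auto simp: inner_commute)
  moreover have "B \<subseteq> - (\<Union>\<alpha>\<in>\<Phi>. root_hyperplane \<alpha>)"
    using assms(1) by (auto simp: chambers_def dest: in_components_subset)
  ultimately show False
    using assms(2) by (auto simp: root_hyperplane_def)
qed

lemma chamber_regular:
  assumes "B \<in> chambers \<Phi>" "b \<in> B"
  shows "regular_point \<Phi> b"
proof -
  have "B \<subseteq> - (\<Union>\<alpha>\<in>\<Phi>. root_hyperplane \<alpha>)"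
    using assms(1) by (auto simp: chambers_def dest: in_components_subset)
  with assms(2) show ?thesis
    by (auto simp: regular_point_def root_hyperplane_def inner_commute)
qed

lemma reflection_group_orbit_chamber_unique:
  assumes W: "root_system_of W \<Phi>" and B: "B \<in> chambers \<Phi>"
    and w: "w \<in> W" and a: "a \<in> B" "w a \<in> B"
  shows "w a = a"
proof -
  have rs: "root_system \<Phi>" and gen: "w \<in> generate orthogonal_group (reflection ` \<Phi>)"
    using W w by (auto simp: root_system_of_def)
  obtain \<beta>s where \<beta>s: "set \<beta>s \<subseteq> \<Phi>" and w_eq: "w = reflection_word \<beta>s"
    using generate_reflections_word[OF gen] by blast
  have "a \<bullet> reflection_word \<beta>s \<beta> > 0" if "\<beta> \<in> positive_roots \<Phi> a" for \<beta>
  proof (rule chamber_root_sign[OF B _ a(2) a(1)])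
    show "reflection_word \<beta>s \<beta> \<in> \<Phi>"
      using that by (intro reflection_word_root[OF rs \<beta>s]) (simp add: positive_roots_def)
    show "w a \<bullet> reflection_word \<beta>s \<beta> > 0"
      using that orthogonal_transformation_reflection_word[of \<beta>s]
      by (simp add: w_eq orthogonal_transformation_def positive_roots_def)
  qed
  then have "w = id"
    unfolding w_eq
    by (rule positivity_preserving_word_id[OF rs chamber_regular[OF B a(1)] \<beta>s])
  then show ?thesis by simp
qed

section \<open>The generating point is determined by the polytope\<close>

text \<open>The orbit lies on a sphere about the origin, and points of a sphere are extreme in the ball,
  hence in any smaller convex set that
  contains them.  So the polytope has exactly the orbit as its vertices.\<close>

lemma orbit_polytope_eq_imp_orbit:
  assumes orth: "\<And>w. w \<in> W \<Longrightarrow> orthogonal_transformation w" and "id \<in> W"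
    and eq: "orbit_polytope W a = orbit_polytope W b"
  shows "\<exists>w\<in>W. b = w a"
proof -
  have sub: "orbit_polytope W c \<subseteq> cball 0 (norm c)" for c
    unfolding orbit_polytope_def
    by (rule hull_minimal) (use orth in \<open>auto simp: orthogonal_transformation_norm\<close>)
  have mem: "c \<in> orbit_polytope W c" for c
    unfolding orbit_polytope_def
    by (rule hull_inc) (rule image_eqI[OF _ assms(2)], simp)
  have "norm b \<le> norm a" "norm a \<le> norm b"
    using sub[of a] sub[of b] mem[of a] mem[of b] eq by (auto simp: subset_iff)
  then have "norm c \<le> norm b" if "c \<in> orbit_polytope W a" for c
    using sub[of a] that by auto
  then have "b extreme_point_of (orbit_polytope W a)"
    using mem[of b] eq dist_decreases_open_segment[of b _ _ 0]
    unfolding extreme_point_of_def by (fastforce simp: not_less)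
  then have "b \<in> (\<lambda>w. w a) ` W"
    unfolding orbit_polytope_def by (rule extreme_point_of_convex_hull)
  then show ?thesis by auto
qed

lemma orbit_polytope_inj_on_chamber:
  assumes W: "root_system_of W \<Phi>" and B: "B \<in> chambers \<Phi>"
  shows "inj_on (orbit_polytope W) B"
proof (rule inj_onI)
  fix a b
  assume ab: "a \<in> B" "b \<in> B" and eq: "orbit_polytope W a = orbit_polytope W b"
  have W_eq: "W = generate orthogonal_group (reflection ` \<Phi>)"
    using W by (simp add: root_system_of_def)
  have "id \<in> W"
    using generate.one[of orthogonal_group] by (simp add: W_eq orthogonal_group_def)
  moreover have "orthogonal_transformation w" if "w \<in> W" for w
    using that generate_reflections_word orthogonal_transformation_reflection_word
    unfolding W_eq by metis
  ultimately obtain w where "w \<in> W" "b = w a"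
    using orbit_polytope_eq_imp_orbit eq by blast
  then show "a = b"
    using reflection_group_orbit_chamber_unique[OF W B] ab by metis
qed

section \<open>The homeomorphism\<close>

text \<open>Rows of the orbit matrix are linear images of the generating point, which makes the matrix
  continuous in that point.\<close>

lemma continuous_map_orbit_matrix:
  fixes B :: "(real^'n) set" and ws :: "(real^'n \<Rightarrow> real^'n) list"
  assumes "\<And>w. w \<in> set ws \<Longrightarrow> linear w"
  shows "continuous_map (top_of_set B) (powertop_real ({..<length ws} \<times> UNIV)) (orbit_matrix ws)"
  unfolding continuous_map_componentwise
proof (intro conjI ballI)
  show "orbit_matrix ws ` topspace (top_of_set B) \<subseteq> extensional ({..<length ws} \<times> UNIV)"
    by (auto simp: orbit_matrix_def)
  fix k :: "nat \<times> 'n"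
  assume k: "k \<in> {..<length ws} \<times> UNIV"
  then obtain i j where ij: "k = (i, j)" "i < length ws" by auto
  then have "continuous_on B (ws ! i)"
    using assms by (intro linear_continuous_on) (simp add: linear_conv_bounded_linear[symmetric])
  then have "continuous_on B (\<lambda>a. (ws ! i) a $ j)"
    by (intro continuous_intros)
  then show "continuous_map (top_of_set B) euclideanreal (\<lambda>a. orbit_matrix ws a k)"
    using ij by (simp add: orbit_matrix_def)
qed

lemma orbit_matrix_first_row:
  assumes "ws \<noteq> []" "hd ws = id"
  shows "(\<chi> j. orbit_matrix ws a (0, j)) = a"
  using assms by (simp add: orbit_matrix_def vec_eq_iff hd_conv_nth)

theorem theorem4p1:
  fixes W :: "(real^'n \<Rightarrow> real^'n) set"
    and \<Phi> B :: "(real^'n) set"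
    and ws :: "(real^'n \<Rightarrow> real^'n) list"
  assumes "finite_reflection_group W"
    and "root_system_of W \<Phi>"
    and "B \<in> chambers \<Phi>"
    and "group_ordering W ws"
  shows "orbit_realization_space W B ws homeomorphic_space top_of_set B"
proof -
  define I where "I = ({..<length ws} \<times> UNIV :: (nat \<times> 'n) set)"
  define row where "row = (\<lambda>M :: nat \<times> 'n \<Rightarrow> real. \<chi> j. M (0, j))"
  have W_eq: "W = generate orthogonal_group (reflection ` \<Phi>)"
    using assms(2) by (simp add: root_system_of_def)
  have set_ws: "set ws = W" and hd_ws: "hd ws = id"
    using assms(4) by (auto simp: group_ordering_def)
  have ne: "ws \<noteq> []"
    using generate.one[of orthogonal_group "reflection ` \<Phi>"] set_ws by (auto simp: W_eq)
  have lin: "linear w" if "w \<in> set ws" for w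
    using that generate_reflections_word orthogonal_transformation_reflection_word
      orthogonal_transformation_linear unfolding set_ws W_eq by metis
  have matrix: "realization_matrix W B ws (orbit_polytope W a) = orbit_matrix ws a" if "a \<in> B" for a
  proof -
    have "(THE a'. a' \<in> B \<and> orbit_polytope W a = orbit_polytope W a') = a"
      using that orbit_polytope_inj_on_chamber[OF assms(2,3)] by (auto simp: inj_on_def)
    then show ?thesis by (simp add: realization_matrix_def)
  qed
  have cont: "continuous_map (top_of_set B) (powertop_real I) (orbit_matrix ws)"
    unfolding I_def by (rule continuous_map_orbit_matrix[OF lin])
  have "continuous_map (top_of_set B) (orbit_realization_space W B ws) (orbit_polytope W)"
    unfolding orbit_realization_space_def I_def[symmetric]
  proof (rule continuous_map_pullback')
    show "continuous_map (top_of_set B) (powertop_real I)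
        (realization_matrix W B ws \<circ> orbit_polytope W)"
      by (rule continuous_map_eq[OF cont]) (simp add: matrix)
    show "topspace (top_of_set B) \<subseteq> orbit_polytope W -` orbit_realizations W B"
      by (auto simp: orbit_realizations_def)
  qed
  moreover have "continuous_map (orbit_realization_space W B ws) (top_of_set B)
      (row \<circ> realization_matrix W B ws)"
  proof -
    have "(0, j) \<in> I" for j
      using ne by (simp add: I_def)
    then have "continuous_map (powertop_real I) euclidean row"
      using continuous_map_product_projection[of _ I "\<lambda>_. euclideanreal"]
      unfolding row_def continuous_map_atin limitin_canonical_iff
      by (auto intro!: tendsto_vec_lambda)
    then have "continuous_map (orbit_realization_space W B ws) euclidean
        (row \<circ> realization_matrix W B ws)"
      unfolding orbit_realization_space_def I_def[symmetric] by (rule continuous_map_pullback)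
    moreover have "(row \<circ> realization_matrix W B ws) P \<in> B"
      if "P \<in> topspace (orbit_realization_space W B ws)" for P
      using that orbit_matrix_first_row[OF ne hd_ws]
      by (auto simp: orbit_realization_space_def topspace_pullback_topology orbit_realizations_def
          matrix row_def)
    ultimately show ?thesis
      by (auto simp: continuous_map_in_subtopology)
  qed
  moreover have "(row \<circ> realization_matrix W B ws) (orbit_polytope W a) = a" if "a \<in> B" for a
    using that orbit_matrix_first_row[OF ne hd_ws] by (simp add: matrix row_def)
  moreover have "orbit_polytope W ((row \<circ> realization_matrix W B ws) P) = P"
    if "P \<in> topspace (orbit_realization_space W B ws)" for P
    using that orbit_matrix_first_row[OF ne hd_ws]
    by (auto simp: orbit_realization_space_def topspace_pullback_topology orbit_realizations_def
        matrix row_def)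
  ultimately show ?thesis
    unfolding homeomorphic_space_def homeomorphic_maps_def by (intro exI conjI) auto
qed

end
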